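(* Assume (SA1) and (SA3) (see context) hold with $\eta(n)=An^{-\psi}$, $\psi>1$ ($A$ a constant), and (SA4) holds with $\zeta>0$. Let $$\sigma^2=\sum_{k=0}^\infty(2-\delta_{k0})\lim_{r\to\infty}\bar{\mathbb E}\bigl[\mu(f_rf_{r+k})-\mu(f_r)\mu(f_{r+k})\bigr]$$ (the limits exist and the series converges absolutely). Then there is a constant $C>0$ such that $$|\mathbb E\sigma_n^2-\sigma^2|\le C\begin{cases} n^{\frac1\psi-1}, & \zeta>1,\\ (n\log^{-1}n)^{\frac1\psi-1}, & \zeta=1,\\ n^{\frac\zeta\psi-\zeta}, & 0<\zeta<1 \end{cases}$$ for all $n\ge1$ (for all $n\ge2$ in the case $\zeta=1$).
   Context: Setting. $(\Omega_0,\mathcal E)$ and $(X,\mathcal B)$ are measurable spaces, $\mathbb Z_+=\{1,2,\dots\}$, $\mathbb N=\{0,1,\dots\}$, $\Omega=\Omega_0^{\mathbb Z_+}$ with product sigma-algebra $\mathcal F$, and $\mathbb P$ is a probability measure on $(\Omega,\mathcal F)$ (not assumed product or shift-invariant), with expectation $\mathbb E$. $\tau:\Omega\to\Omega$, $\tau(\omega_1,\omega_2,\dots)=(\omega_2,\omega_3,\dots)$ is the shift. For each $\omega_0\in\Omega_0$, $T_{\omega_0}:X\to X$ is measurable. Put $\varphi(n,\omega)=\varphi(n,\omega,\cdot)=T_{\omega_n}\circ\dots\circ T_{\omega_1}$, $\varphi(0,\omega)=\mathrm{id}_X$; for each $n$ the map $(\omega,x)\mapsto\varphi(n,\omega,x)$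 is assumed measurable. $\mu$ is a probability measure on $(X,\mathcal B)$, $\mu(g)=\int g\,d\mu$, and $f:X\to\mathbb R$ is bounded measurable. Put $f_i=f\circ\varphi(i,\omega)$, $\bar f_i=f_i-\mu(f_i)$ and $\sigma_n^2=\sigma_n^2(\omega)=\frac1n\sum_{i=0}^{n-1}\sum_{j=0}^{n-1}\mu(\bar f_i\bar f_j)$. $\delta_{k0}$ is the Kronecker delta. (SA1) There is a non-increasing $\eta:\mathbb N\to[0,\infty)$ with $\sum_i\eta(i)<\infty$ such that, for $\mathbb P$-almost every $\omega$, $|\mu(\bar f_i\bar f_j)|\le\eta(|i-j|)$ for all $i,j\ge0$. (SA3) There is a constant $C\ge0$ such that, for $\mathbb P$-almost every $\omega$ and all $0\le r\le k$, $|\mu(g\circ\varphi(k,\omega))-\mu(g\circ\varphi(k-r,\tau^r\omega))|\le C\eta(k-r)$ for every $g\in\{f\circ\varphi(m,\tau^k\omega):m\ge0\}\cup\{f\cdot(f\circ\varphi(m,\tau^k\omega)):m\ge0\}$, with the same $\eta$ as in (SA1). (SA4) $\mathbb P$ is asymptotically mean stationary with mean $\bar{\mathbb P}$, i.e. there is a probability measure $\bar{\mathbb P}$ on $(\Omega,\mathcal F)$ (necessarily $\tau$-invariant) with $\lim_{n\to\infty}\frac1n\sum_{i=0}^{n-1}\int g\circ\tau^i\,d\mathbb P=\int g\,d\bar{\mathbb P}$ for all bounded measurable $g:\Omega\to\mathbb R$; and there are $C_0>0$, $\zeta>0$ such that $\sup_{r,k\ge0,\,a\in\{1,2\}}\bigl|\frac1n\sum_{i=0}^{n-1}\int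 g^a_{rk}\circ\tau^i\,d\mathbb P-\int g^a_{rk}\,d\bar{\mathbb P}\bigr|\le C_0n^{-\zeta}$ for all $n\ge1$, where $g^1_{rk}(\omega)=\mu(f_rf_{r+k})$ and $g^2_{rk}(\omega)=\mu(f_r)\mu(f_{r+k})$. $\bar{\mathbb E}$ denotes expectation with respect to $\bar{\mathbb P}$. Convention: $\eta(n)=An^{-\psi}$ is understood with $0^{-\psi}:=1$. *)

theory Defs
  imports "HOL-Probability.Probability"
begin

text \<open>
  A noise sequence \<open>(\<omega>\<^sub>1, \<omega>\<^sub>2, \<dots>)\<close> is a function on \<^typ>\<open>nat\<close> that is extensional on
  \<open>{1..}\<close>, so that the product space is the library's \<^const>\<open>PiM\<close> over the positive integers.
  A measurable space is given by a \<^type>\<open>measure\<close> of which only \<^const>\<open>space\<close> and \<^const>\<open>sets\<close>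
  matter; \<open>(X, \<B>)\<close> is \<open>(space \<mu>, sets \<mu>)\<close>.
\<close>

definition noise_space :: "'o measure \<Rightarrow> (nat \<Rightarrow> 'o) measure" where
  "noise_space E = Pi\<^sub>M {1..} (\<lambda>_. E)"

definition shift :: "(nat \<Rightarrow> 'o) \<Rightarrow> (nat \<Rightarrow> 'o)" where
  "shift \<omega> = restrict (\<lambda>i. \<omega> (Suc i)) {1..}"

primrec cocycle :: "('o \<Rightarrow> 'x \<Rightarrow> 'x) \<Rightarrow> nat \<Rightarrow> (nat \<Rightarrow> 'o) \<Rightarrow> 'x \<Rightarrow> 'x" where
  "cocycle T 0 \<omega> = id"
| "cocycle T (Suc n) \<omega> = T (\<omega> (Suc n)) \<circ> cocycle T n \<omega>"

definition obs :: "('o \<Rightarrow> 'x \<Rightarrow> 'x) \<Rightarrow> ('x \<Rightarrow> real) \<Rightarrow> nat \<Rightarrow> (nat \<Rightarrow> 'o) \<Rightarrow> 'x \<Rightarrow> real" where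
  "obs T f i \<omega> = f \<circ> cocycle T i \<omega>"

definition obs_centred ::
    "'x measure \<Rightarrow> ('o \<Rightarrow> 'x \<Rightarrow> 'x) \<Rightarrow> ('x \<Rightarrow> real) \<Rightarrow> nat \<Rightarrow> (nat \<Rightarrow> 'o) \<Rightarrow> 'x \<Rightarrow> real" where
  "obs_centred \<mu> T f i \<omega> x = obs T f i \<omega> x - (\<integral>y. obs T f i \<omega> y \<partial>\<mu>)"

definition sigma_sq_n ::
    "'x measure \<Rightarrow> ('o \<Rightarrow> 'x \<Rightarrow> 'x) \<Rightarrow> ('x \<Rightarrow> real) \<Rightarrow> nat \<Rightarrow> (nat \<Rightarrow> 'o) \<Rightarrow> real" where
  "sigma_sq_n \<mu> T f n \<omega> =
     (1 / real n) * (\<Sum>i<n. \<Sum>j<n. \<integral>x. obs_centred \<mu> T f i \<omega> x * obs_centred \<mu> T f j \<omega> x \<partial>\<mu>)"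

definition SA1 ::
    "(nat \<Rightarrow> 'o) measure \<Rightarrow> 'x measure \<Rightarrow> ('o \<Rightarrow> 'x \<Rightarrow> 'x) \<Rightarrow> ('x \<Rightarrow> real) \<Rightarrow> (nat \<Rightarrow> real) \<Rightarrow> bool" where
  "SA1 P \<mu> T f \<eta> \<longleftrightarrow>
     antimono \<eta> \<and> (\<forall>n. 0 \<le> \<eta> n) \<and> summable \<eta> \<and>
     (AE \<omega> in P. \<forall>i j.
        \<bar>\<integral>x. obs_centred \<mu> T f i \<omega> x * obs_centred \<mu> T f j \<omega> x \<partial>\<mu>\<bar> \<le> \<eta> (nat \<bar>int i - int j\<bar>))"

definition SA3 ::
    "(nat \<Rightarrow> 'o) measure \<Rightarrow> 'x measure \<Rightarrow> ('o \<Rightarrow> 'x \<Rightarrow> 'x) \<Rightarrow> ('x \<Rightarrow> real) \<Rightarrow> (nat \<Rightarrow> real) \<Rightarrow> bool" where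
  "SA3 P \<mu> T f \<eta> \<longleftrightarrow>
     (\<exists>C\<ge>0. AE \<omega> in P. \<forall>k. \<forall>r\<le>k.
        \<forall>g \<in> {obs T f m ((shift ^^ k) \<omega>) | m. True} \<union>
             {(\<lambda>x. f x * obs T f m ((shift ^^ k) \<omega>) x) | m. True}.
          \<bar>(\<integral>x. g (cocycle T k \<omega> x) \<partial>\<mu>) - (\<integral>x. g (cocycle T (k - r) ((shift ^^ r) \<omega>) x) \<partial>\<mu>)\<bar>
            \<le> C * \<eta> (k - r))"

definition g1 ::
    "'x measure \<Rightarrow> ('o \<Rightarrow> 'x \<Rightarrow> 'x) \<Rightarrow> ('x \<Rightarrow> real) \<Rightarrow> nat \<Rightarrow> nat \<Rightarrow> (nat \<Rightarrow> 'o) \<Rightarrow> real" where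
  "g1 \<mu> T f r k \<omega> = (\<integral>x. obs T f r \<omega> x * obs T f (r + k) \<omega> x \<partial>\<mu>)"

definition g2 ::
    "'x measure \<Rightarrow> ('o \<Rightarrow> 'x \<Rightarrow> 'x) \<Rightarrow> ('x \<Rightarrow> real) \<Rightarrow> nat \<Rightarrow> nat \<Rightarrow> (nat \<Rightarrow> 'o) \<Rightarrow> real" where
  "g2 \<mu> T f r k \<omega> = (\<integral>x. obs T f r \<omega> x \<partial>\<mu>) * (\<integral>x. obs T f (r + k) \<omega> x \<partial>\<mu>)"

definition shift_average :: "(nat \<Rightarrow> 'o) measure \<Rightarrow> ((nat \<Rightarrow> 'o) \<Rightarrow> real) \<Rightarrow> nat \<Rightarrow> real" where
  "shift_average P g n = (1 / real n) * (\<Sum>i<n. \<integral>\<omega>. g ((shift ^^ i) \<omega>) \<partial>P)"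

definition asymptotically_mean_stationary ::
    "(nat \<Rightarrow> 'o) measure \<Rightarrow> (nat \<Rightarrow> 'o) measure \<Rightarrow> bool" where
  "asymptotically_mean_stationary P Pbar \<longleftrightarrow>
     prob_space Pbar \<and> sets Pbar = sets P \<and>
     (\<forall>g \<in> borel_measurable P. (\<exists>B. \<forall>\<omega>\<in>space P. \<bar>g \<omega>\<bar> \<le> B) \<longrightarrow>
        shift_average P g \<longlonglongrightarrow> (\<integral>\<omega>. g \<omega> \<partial>Pbar))"

text \<open>The mean \<open>Pbar\<close> is determined by \<open>P\<close>, so it is a parameter rather than quantified here.\<close>

definition SA4 ::
    "(nat \<Rightarrow> 'o) measure \<Rightarrow> (nat \<Rightarrow> 'o) measure \<Rightarrow> 'x measure \<Rightarrow> ('o \<Rightarrow> 'x \<Rightarrow> 'x) \<Rightarrow> ('x \<Rightarrow> real) \<Rightarrow>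
      real \<Rightarrow> bool" where
  "SA4 P Pbar \<mu> T f \<zeta> \<longleftrightarrow>
     asymptotically_mean_stationary P Pbar \<and> \<zeta> > 0 \<and>
     (\<exists>C0>0. \<forall>n\<ge>1. \<forall>r k. \<forall>g \<in> {g1 \<mu> T f r k, g2 \<mu> T f r k}.
        \<bar>shift_average P g n - (\<integral>\<omega>. g \<omega> \<partial>Pbar)\<bar> \<le> C0 * real n powr (-\<zeta>))"

definition mean_cov ::
    "(nat \<Rightarrow> 'o) measure \<Rightarrow> 'x measure \<Rightarrow> ('o \<Rightarrow> 'x \<Rightarrow> 'x) \<Rightarrow> ('x \<Rightarrow> real) \<Rightarrow> nat \<Rightarrow> nat \<Rightarrow> real" where
  "mean_cov Pbar \<mu> T f k r = (\<integral>\<omega>. g1 \<mu> T f r k \<omega> - g2 \<mu> T f r k \<omega> \<partial>Pbar)"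

definition sigma_sq_term ::
    "(nat \<Rightarrow> 'o) measure \<Rightarrow> 'x measure \<Rightarrow> ('o \<Rightarrow> 'x \<Rightarrow> 'x) \<Rightarrow> ('x \<Rightarrow> real) \<Rightarrow> nat \<Rightarrow> real" where
  "sigma_sq_term Pbar \<mu> T f k = (2 - (if k = 0 then 1 else 0)) * lim (mean_cov Pbar \<mu> T f k)"

definition sigma_sq ::
    "(nat \<Rightarrow> 'o) measure \<Rightarrow> 'x measure \<Rightarrow> ('o \<Rightarrow> 'x \<Rightarrow> 'x) \<Rightarrow> ('x \<Rightarrow> real) \<Rightarrow> real" where
  "sigma_sq Pbar \<mu> T f = (\<Sum>k. sigma_sq_term Pbar \<mu> T f k)"

text \<open>The case \<open>n = 0\<close> is separate because \<open>0 powr a = 0\<close> whereas here \<open>0\<close> to the power \<open>-\<psi>\<close> is 1.\<close>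

definition poly_decay :: "real \<Rightarrow> real \<Rightarrow> nat \<Rightarrow> real" where
  "poly_decay A \<psi> n = A * (if n = 0 then 1 else real n powr (-\<psi>))"

definition variance_rate :: "real \<Rightarrow> real \<Rightarrow> nat \<Rightarrow> real" where
  "variance_rate \<psi> \<zeta> n =
     (if \<zeta> > 1 then real n powr (1 / \<psi> - 1)
      else if \<zeta> = 1 then (real n / ln (real n)) powr (1 / \<psi> - 1)
      else real n powr (\<zeta> / \<psi> - \<zeta>))"

end

theory Submission
  imports Defs
begin

text \<open>
  Let \<open>w i k\<close> be the \<open>P\<close>-expectation of the covariance, under \<open>\<mu>\<close>, of the observations at the
  times \<open>i\<close> and \<open>i + k\<close>. Grouping by the lag \<open>k\<close>, the expected variance
  is \<open>\<Sum>k<n. (2 - \<delta>\<^sub>k\<^sub>0) (1/n) \<Sum>i<n-k. w i k\<close>, and (SA1) bounds \<open>w i k\<close> by \<open>\<eta> k\<close>.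

  By (SA3) the covariance forgets its past: the covariance at time \<open>r + i\<close> along \<open>\<omega>\<close> is the
  covariance at time \<open>r\<close> along \<open>\<tau>\<^sup>i \<omega>\<close>, up to a multiple of \<open>\<eta> r\<close>. Hence the average of
  \<open>w (r + i) k\<close> over a window \<open>i < n\<close> is, up to \<open>O(\<eta> r)\<close>, an ergodic average of one fixed
  function, and (SA4) puts it within \<open>O(n powr -\<zeta>)\<close> of the stationary mean \<open>V r k\<close>.
  Windows starting at different places share most of their entries, so the means
  \<open>V r k\<close> form a Cauchy sequence in \<open>r\<close>, with limit \<open>L k\<close> at distance \<open>O(\<eta> r)\<close>, and
  \<open>\<bar>L k\<bar> \<le> \<eta> k\<close>. This step is what allows quantities under the stationary measure to be
  controlled, although (SA1) and (SA3) speak of \<open>P\<close>-almost every point only.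

  For the rate, a cut-off \<open>K\<close> serves both as the largest lag and as the starting point
  of the window. Lags from \<open>K\<close> on cost the tail of \<open>\<Sum> \<eta>\<close>, of order \<open>K powr (1-\<psi>)\<close>; each lag
  below \<open>K\<close> costs \<open>K \<eta> k / n\<close> for moving the window to start at \<open>K\<close>, plus
  \<open>O(n powr -\<zeta> + \<eta> K)\<close>. In total the error is
  \<open>O(K / n + K n powr -\<zeta> + K powr (1-\<psi>))\<close> (lemma \<open>variance_error\<close> for general \<open>\<eta>\<close>).
  With \<open>\<beta> = min \<zeta> 1\<close> the terms balance at \<open>K = n powr (\<beta>/\<psi>)\<close> and give
  \<open>n powr (\<beta>/\<psi> - \<beta>)\<close>. For \<open>\<zeta> = 1\<close> this is stronger than the claimed rate, which carries an
  additional power of \<open>ln n\<close>.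
\<close>

section \<open>Elementary sums\<close>

lemma sum_window_diff:
  fixes a :: "nat \<Rightarrow> real"
  assumes "\<And>i. \<bar>a i\<bar> \<le> c"
  shows "\<bar>(\<Sum>i<n. a (s + i)) - (\<Sum>i<n. a i)\<bar> \<le> 2 * real s * c"
proof -
  have bound: "\<bar>\<Sum>i<m. b i\<bar> \<le> real m * c" if "\<And>i. \<bar>b i\<bar> \<le> c" for m and b :: "nat \<Rightarrow> real"
    using order_trans[OF sum_abs sum_bounded_above[of "{..<m}" "\<lambda>i. \<bar>b i\<bar>" c]] that by simp
  have split: "(\<Sum>i<p+q. a i) = (\<Sum>i<p. a i) + (\<Sum>i<q. a (p + i))" for p q
    by (induction q) auto
  have "\<bar>(\<Sum>i<n. a (s + i)) - (\<Sum>i<n. a i)\<bar> = \<bar>(\<Sum>i<s. a (n + i)) - (\<Sum>i<s. a i)\<bar>"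
    using split[of s n] split[of n s] by (simp add: add.commute)
  also have "\<dots> \<le> real s * c + real s * c"
    using bound[of "\<lambda>i. a (n + i)" s, OF assms] bound[of a s, OF assms] by linarith
  finally show ?thesis by (simp add: mult_ac)
qed

lemma symmetric_double_sum_by_lag:
  fixes c :: "nat \<Rightarrow> nat \<Rightarrow> real"
  assumes sym: "\<And>i j. c i j = c j i"
  shows "(\<Sum>i<n. \<Sum>j<n. c i j) =
    (\<Sum>k<n. (2 - (if k = 0 then 1 else 0)) * (\<Sum>i<n-k. c i (i + k)))"
proof (induction n)
  case 0
  then show ?case by simp
next
  case (Suc n)
  let ?m = "\<lambda>k. (2 - (if k = (0::nat) then 1 else 0)) :: real"
  have "(\<Sum>k<Suc n. ?m k * (\<Sum>i<Suc n-k. c i (i + k)))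
      = (\<Sum>k<Suc n. ?m k * (\<Sum>i<n-k. c i (i + k)) + ?m k * c (n - k) n)"
    by (intro sum.cong) (auto simp: Suc_diff_le algebra_simps)
  also have "\<dots> = (\<Sum>i<n. \<Sum>j<n. c i j) + (\<Sum>k<Suc n. ?m k * c (n - k) n)"
    using Suc by (simp add: sum.distrib)
  also have "(\<Sum>k<Suc n. ?m k * c (n - k) n) = c n n + 2 * (\<Sum>k<n. c (n - Suc k) n)"
    by (simp only: sum.lessThan_Suc_shift) (simp add: sum_distrib_left)
  also have "(\<Sum>k<n. c (n - Suc k) n) = (\<Sum>i<n. c i n)"
    by (rule sum.nat_diff_reindex)
  also have "(\<Sum>i<n. \<Sum>j<n. c i j) + (c n n + 2 * (\<Sum>i<n. c i n)) = (\<Sum>i<Suc n. \<Sum>j<Suc n. c i j)"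
    using sym by (simp add: sum.distrib)
  finally show ?case by simp
qed

section \<open>Averages of correlations that forget their past\<close>

text \<open>
  The probability theory enters the limit argument only through three arrays: \<open>w i k\<close> is the
  expected covariance with lag \<open>k\<close> at time \<open>i\<close>, \<open>u r k i\<close> is the expected covariance with
  lag \<open>k\<close> at time \<open>r\<close> after the noise has been shifted \<open>i\<close> times, and \<open>V r k\<close> is its
  mean under the stationary measure.
\<close>

locale shifted_correlations =
  fixes \<eta> :: "nat \<Rightarrow> real" and w :: "nat \<Rightarrow> nat \<Rightarrow> real"
    and u :: "nat \<Rightarrow> nat \<Rightarrow> nat \<Rightarrow> real" and V :: "nat \<Rightarrow> nat \<Rightarrow> real" and D C \<zeta> :: real
  assumes eta_nonneg: "0 \<le> \<eta> n" and eta_summable: "summable \<eta>"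
    and corr_le: "\<bar>w i k\<bar> \<le> \<eta> k"
    and forget: "\<bar>w (r + i) k - u r k i\<bar> \<le> D * \<eta> r"
    and ergodic: "1 \<le> n \<Longrightarrow> \<bar>(\<Sum>i<n. u r k i) / real n - V r k\<bar> \<le> C * real n powr (-\<zeta>)"
    and zeta_pos: "0 < \<zeta>"
begin

definition L :: "nat \<Rightarrow> real" where
  "L k = lim (\<lambda>r. V r k)"

lemma eta_tendsto_0: "\<eta> \<longlonglongrightarrow> 0"
  using eta_summable by (rule summable_LIMSEQ_zero)

lemma window_average:
  assumes "1 \<le> n"
  shows "\<bar>(\<Sum>i<n. w (r + i) k) / real n - V r k\<bar> \<le> C * real n powr (-\<zeta>) + D * \<eta> r"
proof -
  have "\<bar>(\<Sum>i<n. w (r + i) k) - (\<Sum>i<n. u r k i)\<bar> \<le> (\<Sum>i<n. \<bar>w (r + i) k - u r k i\<bar>)"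
    by (simp flip: sum_subtractf)
  also have "\<dots> \<le> real n * (D * \<eta> r)"
    using sum_bounded_above[of "{..<n}" "\<lambda>i. \<bar>w (r + i) k - u r k i\<bar>"] forget by simp
  finally have "\<bar>(\<Sum>i<n. w (r + i) k) / real n - (\<Sum>i<n. u r k i) / real n\<bar> \<le> D * \<eta> r"
    using assms by (simp add: abs_divide divide_le_eq mult.commute flip: diff_divide_distrib)
  then show ?thesis
    using ergodic[OF assms, of r k] by linarith
qed

text \<open>
  Two long windows whose starting points differ by \<open>s\<close> have nearly the same average, so
  as the length grows only the two memory errors remain.
\<close>

lemma mean_diff_le: "\<bar>V (r + s) k - V r k\<bar> \<le> D * \<eta> (r + s) + D * \<eta> r"
proof -
  let ?e = "\<lambda>n. 2 * (C * real n powr (-\<zeta>)) + 2 * real s * \<eta> k / real n + (D * \<eta> (r + s) + D * \<eta> r)"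
  have "\<bar>V (r + s) k - V r k\<bar> \<le> ?e n" if n: "1 \<le> n" for n
  proof -
    have "\<bar>(\<Sum>i<n. w (r + (s + i)) k) - (\<Sum>i<n. w (r + i) k)\<bar> \<le> 2 * real s * \<eta> k"
      by (rule sum_window_diff[where a = "\<lambda>i. w (r + i) k"]) (rule corr_le)
    then have "\<bar>(\<Sum>i<n. w (r + s + i) k) / real n - (\<Sum>i<n. w (r + i) k) / real n\<bar>
        \<le> 2 * real s * \<eta> k / real n"
      using n by (simp add: abs_divide divide_right_mono add.assoc flip: diff_divide_distrib)
    then show ?thesis
      using window_average[OF n, of "r + s" k] window_average[OF n, of r k] by linarith
  qed
  moreover have "?e \<longlonglongrightarrow> 2 * (C * 0) + 0 + (D * \<eta> (r + s) + D * \<eta> r)"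
    using zeta_pos
    by (intro tendsto_intros tendsto_neg_powr filterlim_real_sequentially lim_const_over_n) auto
  ultimately show ?thesis
    by (intro LIMSEQ_le_const[where X = ?e]) auto
qed

lemma mean_convergent: "convergent (\<lambda>r. V r k)"
proof -
  have "Cauchy (\<lambda>r. V r k)"
  proof (rule CauchyI')
    fix e :: real
    assume e: "0 < e"
    have "(\<lambda>r. D * \<eta> r) \<longlonglongrightarrow> D * 0"
      by (intro tendsto_intros eta_tendsto_0)
    then have "eventually (\<lambda>r. D * \<eta> r < e / 2) sequentially"
      using e by (intro order_tendstoD(2)[where y = "D * 0"]) auto
    then obtain M where M: "\<And>r. M \<le> r \<Longrightarrow> D * \<eta> r < e / 2"
      by (auto simp: eventually_sequentially)
    show "\<exists>M. \<forall>m\<ge>M. \<forall>n>m. dist (V m k) (V n k) < e"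
    proof (intro exI allI impI)
      fix m n
      assume "M \<le> m" "m < n"
      then show "dist (V m k) (V n k) < e"
        using mean_diff_le[of m "n - m" k] M[of m] M[of n] by (simp add: dist_real_def abs_minus_commute)
    qed
  qed
  then show ?thesis by (rule Cauchy_convergent)
qed

lemma mean_tendsto: "(\<lambda>r. V r k) \<longlonglongrightarrow> L k"
  using mean_convergent unfolding L_def by (simp add: convergent_LIMSEQ_iff)

lemma mean_limit_diff_le: "\<bar>L k - V r k\<bar> \<le> D * \<eta> r"
proof -
  have "(\<lambda>s. \<bar>V (r + s) k - V r k\<bar>) \<longlonglongrightarrow> \<bar>L k - V r k\<bar>"
    using LIMSEQ_ignore_initial_segment[OF mean_tendsto[of k], of r]
    by (intro tendsto_intros) (simp add: add.commute)
  moreover have "(\<lambda>s. D * \<eta> (r + s) + D * \<eta> r) \<longlonglongrightarrow> D * 0 + D * \<eta> r"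
    using LIMSEQ_ignore_initial_segment[OF eta_tendsto_0, of r]
    by (intro tendsto_intros) (simp add: add.commute)
  ultimately have "\<bar>L k - V r k\<bar> \<le> D * 0 + D * \<eta> r"
    by (rule LIMSEQ_le) (auto intro: mean_diff_le)
  then show ?thesis by simp
qed

text \<open>
  The bound on \<open>w\<close> passes to averages over windows, and the window of length \<open>n\<close> starting at
  \<open>n\<close> has an average that converges to \<open>L k\<close>: its length removes the ergodic error and its
  late start the memory error.
\<close>

lemma limit_le: "\<bar>L k\<bar> \<le> \<eta> k"
proof -
  have "\<bar>L k\<bar> \<le> \<eta> k + C * real n powr (-\<zeta>) + 2 * (D * \<eta> n)" if n: "1 \<le> n" for n
  proof -
    have "\<bar>\<Sum>i<n. w (n + i) k\<bar> \<le> (\<Sum>i<n. \<bar>w (n + i) k\<bar>)"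
      by simp
    also have "\<dots> \<le> real n * \<eta> k"
      using sum_bounded_above[of "{..<n}" "\<lambda>i. \<bar>w (n + i) k\<bar>"] corr_le by simp
    finally have "\<bar>(\<Sum>i<n. w (n + i) k) / real n\<bar> \<le> \<eta> k"
      using n by (simp add: abs_divide divide_le_eq mult.commute)
    then show ?thesis
      using window_average[OF n, of n k] mean_limit_diff_le[of k n] by linarith
  qed
  moreover have "(\<lambda>n. \<eta> k + C * real n powr (-\<zeta>) + 2 * (D * \<eta> n)) \<longlonglongrightarrow> \<eta> k + C * 0 + 2 * (D * 0)"
    using zeta_pos
    by (intro tendsto_intros tendsto_neg_powr filterlim_real_sequentially eta_tendsto_0) auto
  ultimately show ?thesis
    by (intro LIMSEQ_le_const[where X = "\<lambda>n. \<eta> k + C * real n powr (-\<zeta>) + 2 * (D * \<eta> n)"]) auto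
qed

lemma small_lag_error:
  assumes n: "1 \<le> n" and k: "k \<le> K"
  shows "\<bar>(\<Sum>i<n-k. w i k) / real n - L k\<bar>
    \<le> 3 * real K * \<eta> k / real n + C * real n powr (-\<zeta>) + 2 * (D * \<eta> K)"
proof -
  have "\<bar>(\<Sum>i<n. w i k) - (\<Sum>i<n-k. w i k)\<bar> \<le> real k * \<eta> k"
  proof -
    have "(\<Sum>i<n. w i k) - (\<Sum>i<n-k. w i k) = sum (\<lambda>i. w i k) {n-k..<n}"
      by (simp add: lessThan_atLeast0 sum_diff_nat_ivl)
    moreover have "\<bar>sum (\<lambda>i. w i k) {n-k..<n}\<bar> \<le> (\<Sum>i\<in>{n-k..<n}. \<bar>w i k\<bar>)"
      by (rule sum_abs)
    moreover have "\<dots> \<le> real (card {n-k..<n}) * \<eta> k"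
      by (rule sum_bounded_above) (rule corr_le)
    moreover have "\<dots> \<le> real k * \<eta> k"
      by (intro mult_right_mono eta_nonneg) auto
    ultimately show ?thesis by linarith
  qed
  moreover have "\<bar>(\<Sum>i<n. w (K + i) k) - (\<Sum>i<n. w i k)\<bar> \<le> 2 * real K * \<eta> k"
    by (rule sum_window_diff[where a = "\<lambda>i. w i k"]) (rule corr_le)
  moreover have "real k * \<eta> k \<le> real K * \<eta> k"
    using k by (intro mult_right_mono eta_nonneg) auto
  ultimately have "\<bar>(\<Sum>i<n-k. w i k) - (\<Sum>i<n. w (K + i) k)\<bar> \<le> 3 * real K * \<eta> k"
    by linarith
  then have "\<bar>(\<Sum>i<n-k. w i k) / real n - (\<Sum>i<n. w (K + i) k) / real n\<bar> \<le> 3 * real K * \<eta> k / real n"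
    using n by (simp add: abs_divide divide_right_mono flip: diff_divide_distrib)
  then show ?thesis
    using window_average[OF n, of K k] mean_limit_diff_le[of k K] by linarith
qed

lemma large_lag_error:
  assumes n: "1 \<le> n"
  shows "\<bar>(\<Sum>i<n-k. w i k) / real n - L k\<bar> \<le> 2 * \<eta> k"
proof -
  have "\<bar>\<Sum>i<n-k. w i k\<bar> \<le> (\<Sum>i<n-k. \<bar>w i k\<bar>)"
    by simp
  also have "\<dots> \<le> real (n - k) * \<eta> k"
    using sum_bounded_above[of "{..<n-k}" "\<lambda>i. \<bar>w i k\<bar>"] corr_le by simp
  also have "\<dots> \<le> real n * \<eta> k"
    by (intro mult_right_mono eta_nonneg) auto
  finally have "\<bar>(\<Sum>i<n-k. w i k) / real n\<bar> \<le> \<eta> k"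
    using n by (simp add: abs_divide divide_le_eq mult.commute)
  then show ?thesis
    using limit_le[of k] by linarith
qed

lemma weighted_limit_le: "\<bar>(2 - (if k = 0 then 1 else 0)) * L k\<bar> \<le> 2 * \<eta> k"
  using limit_le[of k] eta_nonneg[of k] by auto

lemma weighted_limits_summable: "summable (\<lambda>k. \<bar>(2 - (if k = 0 then 1 else 0)) * L k\<bar>)"
  by (rule summable_comparison_test'[where g = "\<lambda>k. 2 * \<eta> k" and N = 0])
    (use weighted_limit_le eta_summable in \<open>auto intro: summable_mult\<close>)

text \<open>
  Lags below \<open>K\<close> are estimated by \<open>small_lag_error\<close>, the others by \<open>large_lag_error\<close>. The
  finite sum is compared with the series term by term: for \<open>k \<ge> n\<close> the inner sum is empty.
\<close>

lemma variance_error: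
  assumes n: "1 \<le> n"
  shows "\<bar>(\<Sum>k<n. (2 - (if k = 0 then 1 else 0)) * (\<Sum>i<n-k. w i k)) / real n
      - (\<Sum>k. (2 - (if k = 0 then 1 else 0)) * L k)\<bar>
    \<le> 6 * real K * suminf \<eta> / real n + 2 * real K * (C * real n powr (-\<zeta>) + 2 * (D * \<eta> K))
      + 4 * (\<Sum>k. \<eta> (k + K))"
proof -
  define m where "m = (\<lambda>k. (2 - (if k = (0::nat) then 1 else 0)) :: real)"
  define a where "a = (\<lambda>k. (\<Sum>i<n-k. w i k) / real n)"
  define b where "b = (\<lambda>k. if k < K then 3 * real K * \<eta> k / real n + C * real n powr (-\<zeta>) + 2 * (D * \<eta> K)
    else 2 * \<eta> k)"
  have sums_a: "(\<lambda>k. m k * a k) sums (\<Sum>k<n. m k * a k)"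
    by (rule sums_finite) (auto simp: a_def)
  have sums_L: "(\<lambda>k. m k * L k) sums (\<Sum>k. m k * L k)"
    unfolding m_def using weighted_limits_summable by (intro summable_sums) (rule summable_rabs_cancel)
  have eta_tail: "summable (\<lambda>k. \<eta> (k + K))"
    using eta_summable by (simp add: summable_iff_shift)
  have b_tail: "(\<lambda>k. b (k + K)) = (\<lambda>k. 2 * \<eta> (k + K))"
    by (auto simp: b_def)
  have sum_b: "summable b"
    using eta_tail summable_iff_shift[of b K] by (simp add: b_tail)
  have "(\<Sum>k<K. b k) = 3 * real K / real n * (\<Sum>k<K. \<eta> k)
      + real K * (C * real n powr (-\<zeta>) + 2 * (D * \<eta> K))"
    by (simp add: b_def sum.distrib sum_distrib_left sum_divide_distrib algebra_simps)
  moreover have "3 * real K / real n * (\<Sum>k<K. \<eta> k) \<le> 3 * real K / real n * suminf \<eta>"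
    by (intro mult_left_mono sum_le_suminf eta_summable) (auto intro: eta_nonneg)
  moreover have "suminf b = 2 * (\<Sum>k. \<eta> (k + K)) + (\<Sum>k<K. b k)"
    using suminf_split_initial_segment[OF sum_b, of K] eta_tail by (simp add: b_tail suminf_mult)
  ultimately have suminf_b: "suminf b \<le> 3 * real K / real n * suminf \<eta>
      + real K * (C * real n powr (-\<zeta>) + 2 * (D * \<eta> K)) + 2 * (\<Sum>k. \<eta> (k + K))"
    by linarith
  have term_le: "\<bar>m k * a k - m k * L k\<bar> \<le> 2 * b k" for k
  proof -
    have "\<bar>m k * a k - m k * L k\<bar> = \<bar>m k\<bar> * \<bar>a k - L k\<bar>"
      by (simp add: abs_mult right_diff_distrib flip: abs_mult)
    also have "\<dots> \<le> 2 * b k"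
    proof (rule mult_mono)
      show "\<bar>m k\<bar> \<le> 2" by (simp add: m_def)
      show "\<bar>a k - L k\<bar> \<le> b k"
        using small_lag_error[OF n, of k K] large_lag_error[OF n, of k] by (auto simp: a_def b_def)
    qed auto
    finally show ?thesis .
  qed
  have "(\<Sum>k<n. m k * a k) - (\<Sum>k. m k * L k) = (\<Sum>k. m k * a k - m k * L k)"
    using sums_diff[OF sums_a sums_L] by (rule sums_unique)
  then have "\<bar>(\<Sum>k<n. m k * a k) - (\<Sum>k. m k * L k)\<bar> \<le> (\<Sum>k. 2 * b k)"
    using norm_suminf_le[of "\<lambda>k. m k * a k - m k * L k" "\<lambda>k. 2 * b k"] term_le sum_b
    by (simp add: summable_mult)
  also have "\<dots> = 2 * suminf b"
    using sum_b by (rule suminf_mult)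
  finally have "\<bar>(\<Sum>k<n. m k * a k) - (\<Sum>k. m k * L k)\<bar>
      \<le> 2 * (3 * real K / real n * suminf \<eta>
      + real K * (C * real n powr (-\<zeta>) + 2 * (D * \<eta> K)) + 2 * (\<Sum>k. \<eta> (k + K)))"
    using suminf_b by (rule order_trans[OF _ mult_left_mono]) simp
  moreover have "(\<Sum>k<n. m k * a k) = (\<Sum>k<n. m k * (\<Sum>i<n-k. w i k)) / real n"
    by (simp add: a_def flip: sum_divide_distrib)
  ultimately show ?thesis
    unfolding m_def by (simp add: algebra_simps)
qed

end

section \<open>Polynomial decay and the choice of the cut-off\<close>

text \<open>
  Comparison with the telescoping series of \<open>k powr (1 - \<psi>)\<close>, whose successive
  drops the mean value theorem bounds below by \<open>(\<psi> - 1) * (k + 1) powr -\<psi>\<close>.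
\<close>

lemma poly_decay_tail_le:
  assumes \<psi>: "1 < \<psi>" and A: "0 \<le> A" and K: "1 \<le> K"
  shows "(\<Sum>k. poly_decay A \<psi> (k + K)) \<le> A * (1 + 1 / (\<psi> - 1)) * real K powr (1 - \<psi>)"
proof -
  let ?p = "\<lambda>k. A / (\<psi> - 1) * real (k + K) powr (1 - \<psi>)"
  have step: "poly_decay A \<psi> (Suc k + K) \<le> ?p k - ?p (Suc k)" for k
  proof -
    let ?x = "real (k + K)"
    have x: "0 < ?x" using K by simp
    have "\<exists>z>?x. z < ?x + 1 \<and> (?x + 1) powr (1 - \<psi>) - ?x powr (1 - \<psi>)
        = (?x + 1 - ?x) * ((1 - \<psi>) * z powr (1 - \<psi> - 1))"
      using x by (intro MVT2 has_real_derivative_powr) auto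
    then obtain z where z: "?x < z" "z < ?x + 1"
      and eq: "(?x + 1) powr (1 - \<psi>) - ?x powr (1 - \<psi>) = (1 - \<psi>) * z powr (- \<psi>)"
      by auto
    have "(?x + 1) powr (- \<psi>) \<le> z powr (- \<psi>)"
      using z x \<psi> by (intro powr_mono2') auto
    then have "(\<psi> - 1) * (?x + 1) powr (- \<psi>) \<le> (\<psi> - 1) * z powr (- \<psi>)"
      using \<psi> by (intro mult_left_mono) auto
    also have "\<dots> = ?x powr (1 - \<psi>) - (?x + 1) powr (1 - \<psi>)"
      using eq by (simp add: algebra_simps)
    finally have "A / (\<psi> - 1) * ((\<psi> - 1) * (?x + 1) powr (- \<psi>))
        \<le> A / (\<psi> - 1) * (?x powr (1 - \<psi>) - (?x + 1) powr (1 - \<psi>))"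
      using A \<psi> by (intro mult_left_mono) auto
    then show ?thesis
      using \<psi> by (simp add: poly_decay_def right_diff_distrib add_ac)
  qed
  have p0: "?p \<longlonglongrightarrow> A / (\<psi> - 1) * 0"
    using \<psi> LIMSEQ_ignore_initial_segment[of "\<lambda>n. real n powr (1 - \<psi>)" 0 K]
      tendsto_neg_powr[OF _ filterlim_real_sequentially, of "1 - \<psi>"]
    by (intro tendsto_mult tendsto_const) simp
  then have sums: "(\<lambda>k. ?p k - ?p (Suc k)) sums (?p 0 - A / (\<psi> - 1) * 0)"
    by (rule telescope_sums')
  have nonneg: "0 \<le> poly_decay A \<psi> k" for k
    using A by (simp add: poly_decay_def)
  have summ: "summable (\<lambda>k. poly_decay A \<psi> (Suc k + K))"
    by (rule summable_comparison_test'[OF sums_summable[OF sums], of 0])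
      (use step nonneg in auto)
  have "(\<Sum>k. poly_decay A \<psi> (Suc k + K)) \<le> ?p 0"
    using suminf_le[OF step summ sums_summable[OF sums]] sums_unique[OF sums] by simp
  moreover have "(\<Sum>k. poly_decay A \<psi> (k + K)) = poly_decay A \<psi> K + (\<Sum>k. poly_decay A \<psi> (Suc k + K))"
    using summ suminf_split_head[of "\<lambda>k. poly_decay A \<psi> (k + K)"]
      summable_Suc_iff[of "\<lambda>k. poly_decay A \<psi> (k + K)"] by simp
  moreover have "poly_decay A \<psi> K \<le> A * real K powr (1 - \<psi>)"
    using K A by (auto simp: poly_decay_def intro!: mult_left_mono powr_mono)
  ultimately show ?thesis
    by (simp add: algebra_simps)
qed

lemma (in shifted_correlations) variance_rate_of_poly_decay:
  assumes eta: "\<eta> = poly_decay A \<psi>" and \<psi>: "1 < \<psi>" and \<beta>_def: "\<beta> = min \<zeta> 1"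
  obtains M where "0 < M" and "\<And>n. 1 \<le> n \<Longrightarrow>
    \<bar>(\<Sum>k<n. (2 - (if k = 0 then 1 else 0)) * (\<Sum>i<n-k. w i k)) / real n
      - (\<Sum>k. (2 - (if k = 0 then 1 else 0)) * L k)\<bar> \<le> M * real n powr (\<beta> / \<psi> - \<beta>)"
proof -
  have A: "0 \<le> A"
    using eta_nonneg[of 0] by (simp add: eta poly_decay_def)
  have D: "0 \<le> D * A"
    using order_trans[OF abs_ge_zero forget[of 0 0 0]] by (simp add: eta poly_decay_def)
  have C: "0 \<le> C"
    using order_trans[OF abs_ge_zero ergodic[of 1 0 0]] by simp
  have S: "0 \<le> suminf \<eta>"
    by (intro suminf_nonneg eta_summable) (rule eta_nonneg)
  define M where "M = 12 * suminf \<eta> + 4 * C + 4 * (D * A) + 4 * (A * (1 + 1 / (\<psi> - 1))) + 1"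
  have M: "0 < M"
    using A C D S \<psi> by (simp add: M_def add_nonneg_pos)
  have "\<bar>(\<Sum>k<n. (2 - (if k = 0 then 1 else 0)) * (\<Sum>i<n-k. w i k)) / real n
      - (\<Sum>k. (2 - (if k = 0 then 1 else 0)) * L k)\<bar> \<le> M * real n powr (\<beta> / \<psi> - \<beta>)"
    if n: "1 \<le> n" for n
  proof -
    have n1: "1 \<le> real n" using n by simp
    define R where "R = real n powr (\<beta> / \<psi> - \<beta>)"
    \<comment> \<open>This exponent makes \<open>K * n powr (-\<beta>)\<close> and \<open>K powr (1 - \<psi>)\<close> of the same order.\<close>
    define K where "K = nat \<lceil>real n powr (\<beta> / \<psi>)\<rceil>"
    have x1: "1 \<le> real n powr (\<beta> / \<psi>)"
      using n1 zeta_pos \<psi> by (intro ge_one_powr_ge_zero) (auto simp: \<beta>_def)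
    then have K_ge: "real n powr (\<beta> / \<psi>) \<le> real K"
      and K_le: "real K \<le> 2 * real n powr (\<beta> / \<psi>)"
      by (auto simp: K_def) linarith+
    have K1: "1 \<le> K"
      using x1 K_ge by linarith
    have K_over_n: "real K / real n \<le> 2 * R"
    proof -
      have "real K / real n \<le> 2 * real n powr (\<beta> / \<psi>) / real n"
        using K_le by (intro divide_right_mono) auto
      also have "\<dots> = 2 * real n powr (\<beta> / \<psi> - 1)"
        using n1 by (simp add: powr_diff)
      also have "\<dots> \<le> 2 * R"
        unfolding R_def using n1 by (intro mult_left_mono powr_mono) (auto simp: \<beta>_def)
      finally show ?thesis .
    qed
    have K_zeta: "real K * real n powr (-\<zeta>) \<le> 2 * R"
    proof -
      have "real K * real n powr (-\<zeta>) \<le> 2 * real n powr (\<beta> / \<psi>) * real n powr (-\<zeta>)"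
        using K_le by (intro mult_right_mono) auto
      also have "\<dots> = 2 * real n powr (\<beta> / \<psi> - \<zeta>)"
        by (simp add: powr_diff powr_minus divide_inverse)
      also have "\<dots> \<le> 2 * R"
        unfolding R_def using n1 by (intro mult_left_mono powr_mono) (auto simp: \<beta>_def)
      finally show ?thesis .
    qed
    have K_psi: "real K powr (1 - \<psi>) \<le> R"
    proof -
      have "real K powr (1 - \<psi>) \<le> (real n powr (\<beta> / \<psi>)) powr (1 - \<psi>)"
        using K_ge x1 \<psi> n by (intro powr_mono2') auto
      also have "\<dots> = R"
      proof -
        have "\<beta> / \<psi> * (1 - \<psi>) = \<beta> / \<psi> - \<beta>"
          using \<psi> by (simp add: field_simps)
        then show ?thesis by (simp add: R_def powr_powr)
      qed
      finally show ?thesis .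
    qed
    have eta_K: "real K * \<eta> K = A * real K powr (1 - \<psi>)"
      using K1 by (simp add: eta poly_decay_def powr_diff powr_minus divide_inverse)
    have "6 * real K * suminf \<eta> / real n = 6 * suminf \<eta> * (real K / real n)"
      by simp
    also have "\<dots> \<le> 6 * suminf \<eta> * (2 * R)"
      using S K_over_n by (intro mult_left_mono) auto
    finally have t1: "6 * real K * suminf \<eta> / real n \<le> 12 * suminf \<eta> * R"
      by simp
    have t2: "C * (real K * real n powr (-\<zeta>)) \<le> C * (2 * R)"
      using C K_zeta by (intro mult_left_mono) auto
    have t3: "D * A * real K powr (1 - \<psi>) \<le> D * A * R"
      using D K_psi by (intro mult_left_mono) auto
    have t4: "(\<Sum>k. \<eta> (k + K)) \<le> A * (1 + 1 / (\<psi> - 1)) * R"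
    proof -
      have "A * (1 + 1 / (\<psi> - 1)) * real K powr (1 - \<psi>) \<le> A * (1 + 1 / (\<psi> - 1)) * R"
        using A \<psi> K_psi by (intro mult_left_mono) auto
      then show ?thesis
        using poly_decay_tail_le[OF \<psi> A K1] by (simp add: eta)
    qed
    have "2 * real K * (C * real n powr (-\<zeta>) + 2 * (D * \<eta> K))
        = 2 * (C * (real K * real n powr (-\<zeta>))) + 4 * (D * (real K * \<eta> K))"
      by (simp add: algebra_simps)
    also have "\<dots> = 2 * (C * (real K * real n powr (-\<zeta>))) + 4 * (D * A * real K powr (1 - \<psi>))"
      by (simp add: eta_K)
    finally have "6 * real K * suminf \<eta> / real n + 2 * real K * (C * real n powr (-\<zeta>) + 2 * (D * \<eta> K))
        + 4 * (\<Sum>k. \<eta> (k + K))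
        \<le> 12 * suminf \<eta> * R + 2 * (C * (2 * R)) + 4 * (D * A * R) + 4 * (A * (1 + 1 / (\<psi> - 1)) * R)"
      using t1 t2 t3 t4 by linarith
    also have "\<dots> \<le> M * R"
      by (simp add: M_def R_def algebra_simps)
    finally show ?thesis
      using variance_error[OF n, of K] unfolding R_def by linarith
  qed
  with M show thesis
    by (rule that)
qed

text \<open>
  For \<open>\<zeta> = 1\<close> the claimed rate exceeds \<open>n powr (1/\<psi> - 1)\<close> by the factor
  \<open>(ln n) powr (1 - 1/\<psi>)\<close>, which can only be below 1 at \<open>n = 2\<close>; the constant \<open>ln 2\<close> covers that case.
\<close>

lemma variance_rate_ge:
  assumes \<psi>: "1 < \<psi>" and \<zeta>: "0 < \<zeta>" and n: "1 \<le> n" "\<zeta> = 1 \<longrightarrow> 2 \<le> n" and \<beta>: "\<beta> = min \<zeta> 1"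
  shows "ln 2 * real n powr (\<beta> / \<psi> - \<beta>) \<le> variance_rate \<psi> \<zeta> n"
proof -
  have ln2: "0 < ln (2::real)" "ln (2::real) \<le> 1"
    using ln_2_less_1 by auto
  show ?thesis
  proof (cases "\<zeta> = 1")
    case True
    with n have n2: "2 \<le> real n" by simp
    then have ln_n: "ln 2 \<le> ln (real n)" by simp
    have inv: "0 < 1 / \<psi>" "1 / \<psi> < 1" using \<psi> by auto
    have "ln 2 powr 1 \<le> ln 2 powr (1 - 1 / \<psi>)"
      using ln2 inv by (intro powr_mono') auto
    also have "\<dots> \<le> ln (real n) powr (1 - 1 / \<psi>)"
      using ln2 inv ln_n by (intro powr_mono2) auto
    finally have "ln 2 * real n powr (1 / \<psi> - 1)
        \<le> ln (real n) powr (1 - 1 / \<psi>) * real n powr (1 / \<psi> - 1)"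
      using ln2 by (intro mult_right_mono) auto
    also have "\<dots> = (real n / ln (real n)) powr (1 / \<psi> - 1)"
      using powr_minus_divide[of "ln (real n)" "1 / \<psi> - 1"] n2 by (simp add: powr_divide)
    finally show ?thesis
      using True \<beta> by (simp add: variance_rate_def)
  next
    case False
    then have "variance_rate \<psi> \<zeta> n = real n powr (\<beta> / \<psi> - \<beta>)"
      using \<beta> by (auto simp: variance_rate_def)
    then show ?thesis
      using ln2 by (simp add: mult_left_le_one_le)
  qed
qed

section \<open>The shift and the cocycle\<close>

lemma shift_funpow_apply: "1 \<le> j \<Longrightarrow> (shift ^^ i) \<omega> j = \<omega> (j + i)"
  by (induction i arbitrary: j) (auto simp: shift_def)

lemma shift_measurable: "shift \<in> measurable (noise_space E) (noise_space E)"
  unfolding noise_space_def shift_def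
  by (intro measurable_restrict measurable_component_singleton) auto

lemma shift_funpow_measurable: "(shift ^^ i) \<in> measurable (noise_space E) (noise_space E)"
proof (induction i)
  case 0
  then show ?case by (simp add: id_def)
next
  case (Suc i)
  then show ?case
    using measurable_comp[OF Suc shift_measurable] by (simp add: comp_def)
qed

lemma cocycle_add: "cocycle T (k + m) \<omega> = cocycle T m ((shift ^^ k) \<omega>) \<circ> cocycle T k \<omega>"
  by (induction m) (auto simp: shift_funpow_apply comp_assoc add.commute)

lemma obs_add: "obs T f (k + m) \<omega> x = obs T f m ((shift ^^ k) \<omega>) (cocycle T k \<omega> x)"
  by (simp add: obs_def cocycle_add)

section \<open>Covariances along the noise\<close>

locale noisy_observable = P: prob_space P + M: prob_space \<mu>
  for P :: "(nat \<Rightarrow> 'o) measure" and \<mu> :: "'x measure" +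
  fixes E :: "'o measure" and T :: "'o \<Rightarrow> 'x \<Rightarrow> 'x" and f :: "'x \<Rightarrow> real" and B :: real
  assumes sets_P: "sets P = sets (noise_space E)"
    and cocycle_measurable: "(\<lambda>(\<omega>, x). cocycle T n \<omega> x) \<in> measurable (noise_space E \<Otimes>\<^sub>M \<mu>) \<mu>"
    and f_measurable: "f \<in> borel_measurable \<mu>"
    and f_bounded: "x \<in> space \<mu> \<Longrightarrow> \<bar>f x\<bar> \<le> B"
begin

definition cov :: "nat \<Rightarrow> nat \<Rightarrow> (nat \<Rightarrow> 'o) \<Rightarrow> real" where
  "cov r k \<omega> = g1 \<mu> T f r k \<omega> - g2 \<mu> T f r k \<omega>"

lemma space_P: "space P = space (noise_space E)"
  using sets_P by (rule sets_eq_imp_space_eq)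

lemma shift_funpow_in_space: "\<omega> \<in> space P \<Longrightarrow> (shift ^^ i) \<omega> \<in> space P"
  using measurable_space[OF shift_funpow_measurable] by (simp add: space_P)

lemma bound_nonneg: "0 \<le> B"
  using M.not_empty f_bounded by force

lemma cocycle_section_measurable: "\<omega> \<in> space P \<Longrightarrow> cocycle T n \<omega> \<in> measurable \<mu> \<mu>"
  using measurable_Pair2[OF cocycle_measurable] by (simp add: space_P)

lemma obs_measurable: "\<omega> \<in> space P \<Longrightarrow> obs T f n \<omega> \<in> borel_measurable \<mu>"
  unfolding obs_def by (rule measurable_comp[OF cocycle_section_measurable f_measurable])

lemma obs_bounded: "\<omega> \<in> space P \<Longrightarrow> x \<in> space \<mu> \<Longrightarrow> \<bar>obs T f n \<omega> x\<bar> \<le> B"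
  unfolding obs_def using measurable_space[OF cocycle_section_measurable] f_bounded by auto

lemma obs_mult_bounded:
  "\<omega> \<in> space P \<Longrightarrow> x \<in> space \<mu> \<Longrightarrow> \<bar>obs T f n \<omega> x * obs T f m \<omega> x\<bar> \<le> B * B"
  unfolding abs_mult by (intro mult_mono obs_bounded bound_nonneg) auto

lemma obs_integrable: "\<omega> \<in> space P \<Longrightarrow> integrable \<mu> (obs T f n \<omega>)"
  by (rule M.integrable_const_bound[where B = B]) (auto intro: obs_measurable obs_bounded)

lemma obs_mult_integrable:
  "\<omega> \<in> space P \<Longrightarrow> integrable \<mu> (\<lambda>x. obs T f n \<omega> x * obs T f m \<omega> x)"
  by (rule M.integrable_const_bound[where B = "B * B"])
    (auto intro!: borel_measurable_times obs_measurable obs_mult_bounded)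

lemma abs_integral_le:
  assumes "integrable \<mu> h" and "\<And>x. x \<in> space \<mu> \<Longrightarrow> \<bar>h x\<bar> \<le> c"
  shows "\<bar>\<integral>x. h x \<partial>\<mu>\<bar> \<le> (c :: real)"
proof -
  have "\<bar>\<integral>x. h x \<partial>\<mu>\<bar> \<le> (\<integral>x. \<bar>h x\<bar> \<partial>\<mu>)"
    by (rule integral_abs_bound)
  also have "\<dots> \<le> c"
    using assms by (intro M.integral_le_const) auto
  finally show ?thesis .
qed

lemma obs_mean_bounded: "\<omega> \<in> space P \<Longrightarrow> \<bar>\<integral>x. obs T f n \<omega> x \<partial>\<mu>\<bar> \<le> B"
  by (intro abs_integral_le obs_integrable obs_bounded)

lemma g1_bounded: "\<omega> \<in> space P \<Longrightarrow> \<bar>g1 \<mu> T f r k \<omega>\<bar> \<le> B * B"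
  unfolding g1_def by (intro abs_integral_le obs_mult_integrable obs_mult_bounded)

lemma g2_bounded: "\<omega> \<in> space P \<Longrightarrow> \<bar>g2 \<mu> T f r k \<omega>\<bar> \<le> B * B"
  unfolding g2_def abs_mult by (intro mult_mono obs_mean_bounded bound_nonneg) auto

lemma obs_joint_measurable [measurable]:
  "(\<lambda>(\<omega>, x). obs T f n \<omega> x) \<in> borel_measurable (noise_space E \<Otimes>\<^sub>M \<mu>)"
  using measurable_comp[OF cocycle_measurable f_measurable, of n]
  by (simp add: comp_def obs_def case_prod_unfold)

lemma g1_measurable: "g1 \<mu> T f r k \<in> borel_measurable (noise_space E)"
  unfolding g1_def by measurable

lemma g2_measurable: "g2 \<mu> T f r k \<in> borel_measurable (noise_space E)"
  unfolding g2_def by measurable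

text \<open>
  Stated for an arbitrary measure \<open>Q\<close> on the noise space, because expectations are taken both
  under \<open>P\<close> and under its stationary mean.
\<close>

lemma integrable_shifted:
  assumes "prob_space Q" and Q: "sets Q = sets P"
  shows "integrable Q (\<lambda>\<omega>. g1 \<mu> T f r k ((shift ^^ i) \<omega>))"
    and "integrable Q (\<lambda>\<omega>. g2 \<mu> T f r k ((shift ^^ i) \<omega>))"
proof -
  interpret Q: prob_space Q by fact
  have meas: "measurable Q borel = measurable (noise_space E) borel"
    using Q sets_P by (intro measurable_cong_sets) auto
  have sp: "space Q = space P"
    using Q by (rule sets_eq_imp_space_eq)
  show "integrable Q (\<lambda>\<omega>. g1 \<mu> T f r k ((shift ^^ i) \<omega>))"
    by (rule Q.integrable_const_bound[where B = "B * B"])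
      (auto simp: meas sp intro!: AE_I2 g1_bounded shift_funpow_in_space
        measurable_compose[OF shift_funpow_measurable g1_measurable])
  show "integrable Q (\<lambda>\<omega>. g2 \<mu> T f r k ((shift ^^ i) \<omega>))"
    by (rule Q.integrable_const_bound[where B = "B * B"])
      (auto simp: meas sp intro!: AE_I2 g2_bounded shift_funpow_in_space
        measurable_compose[OF shift_funpow_measurable g2_measurable])
qed

lemma cov_shift_integrable: "integrable P (\<lambda>\<omega>. cov r k ((shift ^^ i) \<omega>))"
  unfolding cov_def by (intro Bochner_Integration.integrable_diff integrable_shifted P.prob_space_axioms refl)

lemma cov_integrable: "integrable P (cov r k)"
  using cov_shift_integrable[of r k 0] by simp

lemma centred_product_integral:
  assumes \<omega>: "\<omega> \<in> space P"
  shows "(\<integral>x. obs_centred \<mu> T f i \<omega> x * obs_centred \<mu> T f (i + k) \<omega> x \<partial>\<mu>) = cov i k \<omega>"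
proof -
  let ?a = "\<integral>x. obs T f i \<omega> x \<partial>\<mu>" and ?b = "\<integral>x. obs T f (i + k) \<omega> x \<partial>\<mu>"
  have "(\<integral>x. obs_centred \<mu> T f i \<omega> x * obs_centred \<mu> T f (i + k) \<omega> x \<partial>\<mu>)
    = (\<integral>x. obs T f i \<omega> x * obs T f (i + k) \<omega> x - ?b * obs T f i \<omega> x - ?a * obs T f (i + k) \<omega> x + ?a * ?b \<partial>\<mu>)"
    by (simp add: obs_centred_def algebra_simps)
  also have "\<dots> = (\<integral>x. obs T f i \<omega> x * obs T f (i + k) \<omega> x \<partial>\<mu>) - ?b * ?a - ?a * ?b + ?a * ?b"
    using obs_integrable[OF \<omega>] obs_mult_integrable[OF \<omega>] by (simp add: M.prob_space)
  finally show ?thesis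
    by (simp add: cov_def g1_def g2_def)
qed

lemma expectation_sigma_sq_n:
  "(\<integral>\<omega>. sigma_sq_n \<mu> T f n \<omega> \<partial>P)
    = (\<Sum>k<n. (2 - (if k = 0 then 1 else 0)) * (\<Sum>i<n-k. \<integral>\<omega>. cov i k \<omega> \<partial>P)) / real n"
proof -
  have "sigma_sq_n \<mu> T f n \<omega>
      = (\<Sum>k<n. (2 - (if k = 0 then 1 else 0)) * (\<Sum>i<n-k. cov i k \<omega>)) / real n"
    if "\<omega> \<in> space P" for \<omega>
    unfolding sigma_sq_n_def
    using symmetric_double_sum_by_lag[of
        "\<lambda>i j. \<integral>x. obs_centred \<mu> T f i \<omega> x * obs_centred \<mu> T f j \<omega> x \<partial>\<mu>" n]
    by (simp add: centred_product_integral[OF that] mult.commute)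
  then have "(\<integral>\<omega>. sigma_sq_n \<mu> T f n \<omega> \<partial>P)
      = (\<integral>\<omega>. (\<Sum>k<n. (2 - (if k = 0 then 1 else 0)) * (\<Sum>i<n-k. cov i k \<omega>)) / real n \<partial>P)"
    by (intro Bochner_Integration.integral_cong) auto
  also have "\<dots> = (\<Sum>k<n. (2 - (if k = 0 then 1 else 0)) * (\<Sum>i<n-k. \<integral>\<omega>. cov i k \<omega> \<partial>P)) / real n"
    by (simp add: cov_integrable Bochner_Integration.integral_sum)
  finally show ?thesis .
qed

lemma abs_expectation_le:
  assumes "integrable P h" and "AE \<omega> in P. \<bar>h \<omega>\<bar> \<le> c"
  shows "\<bar>\<integral>\<omega>. h \<omega> \<partial>P\<bar> \<le> (c :: real)"
proof -
  have "\<bar>\<integral>\<omega>. h \<omega> \<partial>P\<bar> \<le> (\<integral>\<omega>. \<bar>h \<omega>\<bar> \<partial>P)"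
    by (rule integral_abs_bound)
  also have "\<dots> \<le> c"
    using assms by (intro P.integral_le_const) auto
  finally show ?thesis .
qed

lemma expected_cov_le:
  assumes "SA1 P \<mu> T f \<eta>"
  shows "\<bar>\<integral>\<omega>. cov i k \<omega> \<partial>P\<bar> \<le> \<eta> k"
proof (rule abs_expectation_le[OF cov_integrable])
  have "AE \<omega> in P. \<forall>i j.
      \<bar>\<integral>x. obs_centred \<mu> T f i \<omega> x * obs_centred \<mu> T f j \<omega> x \<partial>\<mu>\<bar> \<le> \<eta> (nat \<bar>int i - int j\<bar>)"
    using assms by (simp add: SA1_def)
  with AE_space show "AE \<omega> in P. \<bar>cov i k \<omega>\<bar> \<le> \<eta> k"
  proof eventually_elim
    case (elim \<omega>)
    then show ?case
      using elim(2)[rule_format, of i "i + k"] by (simp add: centred_product_integral)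
  qed
qed

text \<open>
  Both quantities in the covariance are \<open>\<mu>\<close>-integrals of functions of the state at time
  \<open>r + i\<close>, which is where (SA3) allows the first \<open>i\<close> steps to be dropped. The product of the
  two means loses a factor \<open>2 * B\<close>.
\<close>

lemma cov_forgets_past:
  assumes "SA3 P \<mu> T f \<eta>" and nonneg: "\<And>n. 0 \<le> \<eta> n"
  obtains D where "AE \<omega> in P. \<forall>r i k. \<bar>cov (r + i) k \<omega> - cov r k ((shift ^^ i) \<omega>)\<bar> \<le> D * \<eta> r"
proof -
  obtain C where C: "0 \<le> C" and ae: "AE \<omega> in P. \<forall>k. \<forall>r\<le>k.
        \<forall>g \<in> {obs T f m ((shift ^^ k) \<omega>) | m. True} \<union>
             {(\<lambda>x. f x * obs T f m ((shift ^^ k) \<omega>) x) | m. True}.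
          \<bar>(\<integral>x. g (cocycle T k \<omega> x) \<partial>\<mu>) - (\<integral>x. g (cocycle T (k - r) ((shift ^^ r) \<omega>) x) \<partial>\<mu>)\<bar>
            \<le> C * \<eta> (k - r)"
    using assms unfolding SA3_def by blast
  from AE_space ae
  have "AE \<omega> in P. \<forall>r i k. \<bar>cov (r + i) k \<omega> - cov r k ((shift ^^ i) \<omega>)\<bar> \<le> ((1 + 2 * B) * C) * \<eta> r"
  proof eventually_elim
    case (elim \<omega>)
    note \<omega> = elim(1)
    note step = elim(2)[rule_format]
    have shift_shift: "(shift ^^ (r + i)) \<omega> = (shift ^^ r) ((shift ^^ i) \<omega>)" for r i
      by (simp add: funpow_add)
    have obs_shift: "obs T f m ((shift ^^ (r + i)) \<omega>) (cocycle T r ((shift ^^ i) \<omega>) x)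
        = obs T f (r + m) ((shift ^^ i) \<omega>) x" for m r i x
      by (simp only: shift_shift obs_add)
    have mean: "\<bar>(\<integral>x. obs T f (r + i + m) \<omega> x \<partial>\<mu>) - (\<integral>x. obs T f (r + m) ((shift ^^ i) \<omega>) x \<partial>\<mu>)\<bar>
        \<le> C * \<eta> r" for r i m
    proof -
      have "obs T f m ((shift ^^ (r + i)) \<omega>) \<in> {obs T f m ((shift ^^ (r + i)) \<omega>) | m. True} \<union>
             {(\<lambda>x. f x * obs T f m ((shift ^^ (r + i)) \<omega>) x) | m. True}"
        by blast
      from step[OF _ this, of i] show ?thesis
        by (simp only: le_add2 add_diff_cancel_right' obs_shift flip: obs_add)
    qed
    have prod: "\<bar>g1 \<mu> T f (r + i) k \<omega> - g1 \<mu> T f r k ((shift ^^ i) \<omega>)\<bar> \<le> C * \<eta> r" for r i k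
    proof -
      have f_obs: "f (cocycle T n \<omega>' x) = obs T f n \<omega>' x" for n \<omega>' x
        by (simp add: obs_def)
      have "(\<lambda>x. f x * obs T f k ((shift ^^ (r + i)) \<omega>) x) \<in> {obs T f m ((shift ^^ (r + i)) \<omega>) | m. True} \<union>
             {(\<lambda>x. f x * obs T f m ((shift ^^ (r + i)) \<omega>) x) | m. True}"
        by blast
      from step[OF _ this, of i] show ?thesis
        unfolding g1_def by (simp only: le_add2 add_diff_cancel_right' obs_shift f_obs flip: obs_add)
    qed
    show ?case
    proof (intro allI)
      fix r i k
      define a where "a = (\<integral>x. obs T f (r + i) \<omega> x \<partial>\<mu>)"
      define b where "b = (\<integral>x. obs T f (r + i + k) \<omega> x \<partial>\<mu>)"
      define a' where "a' = (\<integral>x. obs T f r ((shift ^^ i) \<omega>) x \<partial>\<mu>)"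
      define b' where "b' = (\<integral>x. obs T f (r + k) ((shift ^^ i) \<omega>) x \<partial>\<mu>)"
      have "\<bar>a * b - a' * b'\<bar> = \<bar>a * (b - b') + b' * (a - a')\<bar>"
        by (simp add: algebra_simps)
      also have "\<dots> \<le> \<bar>a\<bar> * \<bar>b - b'\<bar> + \<bar>b'\<bar> * \<bar>a - a'\<bar>"
        by (metis abs_mult abs_triangle_ineq)
      also have "\<dots> \<le> B * (C * \<eta> r) + B * (C * \<eta> r)"
        using mean[of r i k] mean[of r i 0] bound_nonneg obs_mean_bounded[OF \<omega>]
          obs_mean_bounded[OF shift_funpow_in_space[OF \<omega>]]
        by (intro add_mono mult_mono) (auto simp: a_def b_def a'_def b'_def)
      finally have "\<bar>g2 \<mu> T f (r + i) k \<omega> - g2 \<mu> T f r k ((shift ^^ i) \<omega>)\<bar> \<le> 2 * B * C * \<eta> r"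
        by (simp add: g2_def a_def b_def a'_def b'_def)
      with prod[of r i k]
      show "\<bar>cov (r + i) k \<omega> - cov r k ((shift ^^ i) \<omega>)\<bar> \<le> ((1 + 2 * B) * C) * \<eta> r"
        unfolding cov_def by (simp add: algebra_simps)
    qed
  qed
  then show thesis by (rule that)
qed

lemma shift_average_cov:
  "(\<Sum>i<n. \<integral>\<omega>. cov r k ((shift ^^ i) \<omega>) \<partial>P) / real n
    = shift_average P (g1 \<mu> T f r k) n - shift_average P (g2 \<mu> T f r k) n"
  unfolding shift_average_def cov_def
  by (simp add: integrable_shifted P.prob_space_axioms sum_subtractf diff_divide_distrib)

lemma shifted_correlations_cov:
  assumes SA1: "SA1 P \<mu> T f \<eta>" and SA3: "SA3 P \<mu> T f \<eta>" and SA4: "SA4 P Pbar \<mu> T f \<zeta>"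
  obtains D C where "shifted_correlations \<eta> (\<lambda>i k. \<integral>\<omega>. cov i k \<omega> \<partial>P)
    (\<lambda>r k i. \<integral>\<omega>. cov r k ((shift ^^ i) \<omega>) \<partial>P) (\<lambda>r k. mean_cov Pbar \<mu> T f k r) D C \<zeta>"
proof -
  have eta: "0 \<le> \<eta> n" "summable \<eta>" for n
    using SA1 by (auto simp: SA1_def)
  obtain D where D: "AE \<omega> in P. \<forall>r i k. \<bar>cov (r + i) k \<omega> - cov r k ((shift ^^ i) \<omega>)\<bar> \<le> D * \<eta> r"
    using cov_forgets_past[OF SA3 eta(1)] .
  obtain C where C: "\<And>n r k g. 1 \<le> n \<Longrightarrow> g \<in> {g1 \<mu> T f r k, g2 \<mu> T f r k} \<Longrightarrow>
        \<bar>shift_average P g n - (\<integral>\<omega>. g \<omega> \<partial>Pbar)\<bar> \<le> C * real n powr (-\<zeta>)"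
    using SA4 unfolding SA4_def by blast
  have Pbar: "prob_space Pbar" "sets Pbar = sets P" and \<zeta>: "0 < \<zeta>"
    using SA4 by (auto simp: SA4_def asymptotically_mean_stationary_def)
  have mean: "mean_cov Pbar \<mu> T f k r
      = (\<integral>\<omega>. g1 \<mu> T f r k \<omega> \<partial>Pbar) - (\<integral>\<omega>. g2 \<mu> T f r k \<omega> \<partial>Pbar)" for r k
    using integrable_shifted[OF Pbar, of r k 0] by (simp add: mean_cov_def)
  have "shifted_correlations \<eta> (\<lambda>i k. \<integral>\<omega>. cov i k \<omega> \<partial>P)
    (\<lambda>r k i. \<integral>\<omega>. cov r k ((shift ^^ i) \<omega>) \<partial>P) (\<lambda>r k. mean_cov Pbar \<mu> T f k r) D (2 * C) \<zeta>"
  proof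
    fix r i k n :: nat
    show "\<bar>(\<integral>\<omega>. cov (r + i) k \<omega> \<partial>P) - (\<integral>\<omega>. cov r k ((shift ^^ i) \<omega>) \<partial>P)\<bar> \<le> D * \<eta> r"
    proof -
      have "\<bar>\<integral>\<omega>. cov (r + i) k \<omega> - cov r k ((shift ^^ i) \<omega>) \<partial>P\<bar> \<le> D * \<eta> r"
        by (intro abs_expectation_le Bochner_Integration.integrable_diff cov_integrable cov_shift_integrable)
          (use D in \<open>auto elim: eventually_mono\<close>)
      then show ?thesis
        by (simp add: cov_integrable cov_shift_integrable)
    qed
    show "\<bar>(\<Sum>i<n. \<integral>\<omega>. cov r k ((shift ^^ i) \<omega>) \<partial>P) / real n - mean_cov Pbar \<mu> T f k r\<bar>
        \<le> 2 * C * real n powr (-\<zeta>)" if "1 \<le> n"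
      using C[OF that, of "g1 \<mu> T f r k" r k] C[OF that, of "g2 \<mu> T f r k" r k]
      unfolding shift_average_cov mean by simp
  qed (use eta \<zeta> expected_cov_le[OF SA1] in auto)
  then show thesis by (rule that)
qed

end

section \<open>The rate for the expected variance\<close>

theorem theorem3p9:
  fixes E :: "'o measure" and \<mu> :: "'x measure" and P Pbar :: "(nat \<Rightarrow> 'o) measure"
    and T :: "'o \<Rightarrow> 'x \<Rightarrow> 'x" and f :: "'x \<Rightarrow> real" and A \<psi> \<zeta> :: real
  assumes "prob_space P" and "sets P = sets (noise_space E)"
    and "prob_space \<mu>"
    and "\<And>\<omega>0. \<omega>0 \<in> space E \<Longrightarrow> T \<omega>0 \<in> measurable \<mu> \<mu>"
    and "\<And>n. (\<lambda>(\<omega>, x). cocycle T n \<omega> x) \<in> measurable (noise_space E \<Otimes>\<^sub>M \<mu>) \<mu>"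
    and "f \<in> borel_measurable \<mu>" and "\<exists>B. \<forall>x\<in>space \<mu>. \<bar>f x\<bar> \<le> B"
    and "\<psi> > 1"
    and "SA1 P \<mu> T f (poly_decay A \<psi>)"
    and "SA3 P \<mu> T f (poly_decay A \<psi>)"
    and "SA4 P Pbar \<mu> T f \<zeta>"
  shows "(\<forall>k. convergent (mean_cov Pbar \<mu> T f k)) \<and>
         summable (\<lambda>k. \<bar>sigma_sq_term Pbar \<mu> T f k\<bar>) \<and>
         (\<exists>C>0. \<forall>n\<ge>1. (\<zeta> = 1 \<longrightarrow> n \<ge> 2) \<longrightarrow>
            \<bar>(\<integral>\<omega>. sigma_sq_n \<mu> T f n \<omega> \<partial>P) - sigma_sq Pbar \<mu> T f\<bar>
              \<le> C * variance_rate \<psi> \<zeta> n)"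
proof -
  obtain B where B: "\<forall>x\<in>space \<mu>. \<bar>f x\<bar> \<le> B"
    using assms(7) by blast
  interpret prob_space P by fact
  interpret M: prob_space \<mu> by fact
  interpret noisy_observable P \<mu> E T f B
    by unfold_locales (use assms(2,5,6) B in auto)
  obtain D C where "shifted_correlations (poly_decay A \<psi>) (\<lambda>i k. \<integral>\<omega>. cov i k \<omega> \<partial>P)
    (\<lambda>r k i. \<integral>\<omega>. cov r k ((shift ^^ i) \<omega>) \<partial>P) (\<lambda>r k. mean_cov Pbar \<mu> T f k r) D C \<zeta>"
    using shifted_correlations_cov[OF assms(9-11)] .
  then interpret S: shifted_correlations "poly_decay A \<psi>" "\<lambda>i k. \<integral>\<omega>. cov i k \<omega> \<partial>P"
    "\<lambda>r k i. \<integral>\<omega>. cov r k ((shift ^^ i) \<omega>) \<partial>P" "\<lambda>r k. mean_cov Pbar \<mu> T f k r" D C \<zeta> .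
  have sigma_term: "sigma_sq_term Pbar \<mu> T f k = (2 - (if k = 0 then 1 else 0)) * S.L k" for k
    by (simp add: sigma_sq_term_def S.L_def)
  define \<beta> where "\<beta> = min \<zeta> 1"
  obtain R where R: "0 < R" and rate: "\<And>n. 1 \<le> n \<Longrightarrow>
      \<bar>(\<integral>\<omega>. sigma_sq_n \<mu> T f n \<omega> \<partial>P) - sigma_sq Pbar \<mu> T f\<bar> \<le> R * real n powr (\<beta> / \<psi> - \<beta>)"
    using S.variance_rate_of_poly_decay[OF refl assms(8) \<beta>_def]
    unfolding expectation_sigma_sq_n sigma_sq_def sigma_term by blast
  have "\<bar>(\<integral>\<omega>. sigma_sq_n \<mu> T f n \<omega> \<partial>P) - sigma_sq Pbar \<mu> T f\<bar> \<le> R / ln 2 * variance_rate \<psi> \<zeta> n"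
    if n: "1 \<le> n" "\<zeta> = 1 \<longrightarrow> 2 \<le> n" for n
  proof -
    have "R / ln 2 * (ln 2 * real n powr (\<beta> / \<psi> - \<beta>)) \<le> R / ln 2 * variance_rate \<psi> \<zeta> n"
      using R by (intro mult_left_mono variance_rate_ge assms(8) S.zeta_pos n \<beta>_def) auto
    then show ?thesis
      using rate[OF n(1)] by simp
  qed
  then have "\<exists>C>0. \<forall>n\<ge>1. (\<zeta> = 1 \<longrightarrow> n \<ge> 2) \<longrightarrow>
      \<bar>(\<integral>\<omega>. sigma_sq_n \<mu> T f n \<omega> \<partial>P) - sigma_sq Pbar \<mu> T f\<bar> \<le> C * variance_rate \<psi> \<zeta> n"
    using R by (intro exI[of _ "R / ln 2"]) auto
  moreover have "convergent (mean_cov Pbar \<mu> T f k)" for k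
    using S.mean_convergent[of k] by simp
  moreover have "summable (\<lambda>k. \<bar>sigma_sq_term Pbar \<mu> T f k\<bar>)"
    unfolding sigma_term by (rule S.weighted_limits_summable)
  ultimately show ?thesis by blast
qed

end
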